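(* For every integer $n \ge 3$, the lower rank of the semigroup ${\rm End}(B_n)$ is $r_2({\rm End}(B_n)) = 4$.
   Context: For an integer $n \ge 1$ let $[n] = \{1,\ldots,n\}$. The Brandt semigroup $(B_n,+)$ has underlying set $B_n = ([n]\times[n]) \cup \{\vartheta\}$, with operation $(i,j)+(k,l) = (i,l)$ if $j=k$ and $(i,j)+(k,l)=\vartheta$ if $j\neq k$, and $\alpha+\vartheta=\vartheta+\alpha=\vartheta$ for all $\alpha\in B_n$. ${\rm End}(B_n)$ is the semigroup, under composition of mappings, of all semigroup endomorphisms of $(B_n,+)$, i.e. all maps $f: B_n\to B_n$ with $(\alpha+\beta)f = \alpha f+\beta f$; maps are written on the right, so $fg$ means first $f$, then $g$. For a finite semigroup $\Gamma$, the lower rank is $r_2(\Gamma)=\min\{|U| : U\subseteq\Gamma,\ \langle U\rangle=\Gamma\}$, where $\langle U\rangle$ is the subsemigroup generated by $U$. *)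

theory Defs
  imports Main "HOL-Library.FuncSet"
begin

inductive_set subsemigroup_gen :: "('a \<Rightarrow> 'a \<Rightarrow> 'a) \<Rightarrow> 'a set \<Rightarrow> 'a set"
  for mul :: "'a \<Rightarrow> 'a \<Rightarrow> 'a" and U :: "'a set" where
  base: "x \<in> U \<Longrightarrow> x \<in> subsemigroup_gen mul U"
| mult: "\<lbrakk>x \<in> subsemigroup_gen mul U; y \<in> subsemigroup_gen mul U\<rbrakk>
         \<Longrightarrow> mul x y \<in> subsemigroup_gen mul U"

(* Meant for a finite carrier S; "finite U" only guards against card U = 0 for infinite U. *)
definition lower_rank :: "'a set \<Rightarrow> ('a \<Rightarrow> 'a \<Rightarrow> 'a) \<Rightarrow> nat" where
  "lower_rank S mul =
     (LEAST k. \<exists>U. U \<subseteq> S \<and> finite U \<and> subsemigroup_gen mul U = S \<and> card U = k)"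

(* Endomorphisms are maps of the carrier only: taking them extensional makes equality of
   functions the same as equality on S. *)
definition semigroup_End :: "'a set \<Rightarrow> ('a \<Rightarrow> 'a \<Rightarrow> 'a) \<Rightarrow> ('a \<Rightarrow> 'a) set" where
  "semigroup_End S add =
     {f \<in> S \<rightarrow>\<^sub>E S. \<forall>x\<in>S. \<forall>y\<in>S. f (add x y) = add (f x) (f y)}"

(* Maps are written on the right: the product f g is first f, then g. *)
definition End_mult :: "'a set \<Rightarrow> ('a \<Rightarrow> 'a) \<Rightarrow> ('a \<Rightarrow> 'a) \<Rightarrow> ('a \<Rightarrow> 'a)" where
  "End_mult S f g = compose S g f"

datatype brandt = Elem nat nat | Theta

definition Brandt :: "nat \<Rightarrow> brandt set" where
  "Brandt n = {Elem i j | i j. i \<in> {1..n} \<and> j \<in> {1..n}} \<union> {Theta}"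

fun brandt_add :: "brandt \<Rightarrow> brandt \<Rightarrow> brandt" where
  "brandt_add (Elem i j) (Elem k l) = (if j = k then Elem i l else Theta)"
| "brandt_add Theta b = Theta"
| "brandt_add a Theta = Theta"

lemma brandt_add_closed: "a \<in> Brandt n \<Longrightarrow> b \<in> Brandt n \<Longrightarrow> brandt_add a b \<in> Brandt n"
  by (cases a; cases b) (simp_all add: Brandt_def)

lemma brandt_add_assoc: "brandt_add (brandt_add a b) c = brandt_add a (brandt_add b c)"
  by (cases a; cases b; cases c) simp_all

lemma End_mult_closed:
  assumes f: "f \<in> semigroup_End S add" and g: "g \<in> semigroup_End S add"
    and S: "\<And>x y. x \<in> S \<Longrightarrow> y \<in> S \<Longrightarrow> add x y \<in> S"
  shows "End_mult S f g \<in> semigroup_End S add"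
proof -
  have fS: "f x \<in> S" if "x \<in> S" for x
    using f that unfolding semigroup_End_def by blast
  have gS: "g x \<in> S" if "x \<in> S" for x
    using g that unfolding semigroup_End_def by blast
  have fadd: "f (add x y) = add (f x) (f y)" if "x \<in> S" "y \<in> S" for x y
    using f that unfolding semigroup_End_def by blast
  have gadd: "g (add x y) = add (g x) (g y)" if "x \<in> S" "y \<in> S" for x y
    using g that unfolding semigroup_End_def by blast
  have "compose S g f \<in> S \<rightarrow>\<^sub>E S"
    by (rule PiE_I) (simp_all add: compose_def fS gS)
  moreover have "compose S g f (add x y) = add (compose S g f x) (compose S g f y)"
    if "x \<in> S" "y \<in> S" for x y
    using that by (simp add: compose_def S fS fadd gadd)
  ultimately show ?thesis
    unfolding semigroup_End_def End_mult_def by blast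
qed

end

theory Submission
  imports Defs "HOL-Combinatorics.Cycles"
begin

text \<open>
  The Brandt semigroup has very few endomorphisms, because every nonzero element divides every
  other one: if an endomorphism sends \<open>\<vartheta>\<close> to an idempotent \<open>(k,k)\<close>, or sends some pair to
  \<open>\<vartheta>\<close>, then it is constant; otherwise it permutes the nonzero idempotents \<open>(i,i)\<close>, and
  \<open>(i,j) = (i,i) + (i,j) + (j,j)\<close> shows that this permutation determines it. Hence the
  endomorphism semigroup consists of a copy of the symmetric group on \<open>[n]\<close>, the \<open>n\<close> constant
  maps onto the idempotents \<open>(k,k)\<close>, and the constant map onto \<open>\<vartheta>\<close>
  (\<open>semigroup_End_Brandt\<close>).

  Four generators suffice. A transposition and an \<open>n\<close>-cycle generate the symmetric group even
  as a semigroup, because a finite order makes inverses available as powers. A single constant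
  map onto \<open>(1,1)\<close> gives the one onto \<open>(k,k)\<close> when it is followed by a permutation that takes
  \<open>1\<close> to \<open>k\<close>. The constant map onto \<open>\<vartheta>\<close> is the fourth generator.

  Fewer do not suffice, because each of the three strata has to be met by the generating set
  itself. A product that involves a constant map is constant, so the generators that are
  permutations must already generate the symmetric group; one permutation generates only a
  commutative semigroup, whereas the symmetric group is not commutative for \<open>n \<ge> 3\<close>. The
  permutations and the constant map onto \<open>\<vartheta>\<close> fix \<open>\<vartheta>\<close>, so without a constant map onto
  some \<open>(k,k)\<close> no product moves \<open>\<vartheta>\<close>.
  Finally, a product is the constant map onto \<open>\<vartheta>\<close> only if one of the factors is.
\<close>

section \<open>Generated subsemigroups\<close>

text \<open>
  To show that certain generators are indispensable, one exhibits a proper closed subset \<open>V\<close>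
  that contains all the others.
\<close>

lemma subsemigroup_gen_least:
  assumes "U \<subseteq> V" and "\<And>x y. x \<in> V \<Longrightarrow> y \<in> V \<Longrightarrow> mul x y \<in> V"
  shows "subsemigroup_gen mul U \<subseteq> V"
proof
  fix x assume "x \<in> subsemigroup_gen mul U"
  then show "x \<in> V"
    by induction (use assms in auto)
qed

section \<open>Two generators of the symmetric group\<close>

definition rotation :: "nat \<Rightarrow> nat \<Rightarrow> nat" where
  "rotation n i = (if i \<in> {1..n} then if i = n then 1 else Suc i else i)"

lemma rotation_permutes: "rotation n permutes {1..n}"
  by (rule inj_imp_permutes) (auto simp: rotation_def inj_on_def split: if_splits)

lemma comp_transpose_comp_inv:
  assumes "bij p"
  shows "p \<circ> transpose a b \<circ> inv p = transpose (p a) (p b)"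
proof -
  have "transpose (p a) (p b) \<circ> p = p \<circ> transpose a b"
    using transpose_comp_eq[OF assms, of "p a" "p b"] assms by (simp add: bij_is_inj)
  then have "p \<circ> transpose a b \<circ> inv p = transpose (p a) (p b) \<circ> (p \<circ> inv p)"
    by (metis comp_assoc)
  then show ?thesis
    using assms by (simp add: bij_is_surj surj_iff[THEN iffD1])
qed

text \<open>
  Finite order turns inverses into powers, so closure under composition already makes
  conjugation by the cycle available. Conjugating the transposition \<open>(1 2)\<close> repeatedly by the
  cycle gives all \<open>(k k+1)\<close>; these combine to all \<open>(1 k)\<close>, hence to all transpositions.
\<close>

lemma permutations_generated_by_transposition_and_rotation:
  fixes n :: nat
  assumes n: "n \<ge> 2"
    and t: "transpose 1 2 \<in> H" and c: "rotation n \<in> H"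
    and closed: "\<And>p q. p \<in> H \<Longrightarrow> q \<in> H \<Longrightarrow> p \<circ> q \<in> H"
    and p: "p permutes {1..n}"
  shows "p \<in> H"
proof -
  define c where "c = rotation n"
  have c_perm: "c permutes {1..n}"
    unfolding c_def by (rule rotation_permutes)
  have id: "id \<in> H"
    using closed[OF t t] by simp
  have powers: "c ^^ k \<in> H" for k
  proof (induction k)
    case 0
    show ?case using id by (simp only: funpow.simps)
  next
    case (Suc k)
    show ?case using closed[OF c Suc] by (simp only: funpow.simps c_def)
  qed
  have c_inv: "inv c \<in> H"
  proof -
    have "permutation c"
      using c_perm by (auto simp: permutation_permutes)
    then obtain m where m: "c ^^ m = id" "m > 0"
      using permutation_is_nilpotent by blast
    then have "c \<circ> c ^^ (m - 1) = id"
      by (cases m) simp_all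
    then have "inv c = (inv c \<circ> c) \<circ> c ^^ (m - 1)"
      by (simp add: comp_assoc)
    then have "inv c = c ^^ (m - 1)"
      by (simp add: permutes_inv_o[OF c_perm])
    then show ?thesis
      using powers by simp
  qed
  have adjacent: "transpose (Suc k) (Suc (Suc k)) \<in> H" if "Suc (Suc k) \<le> n" for k
    using that
  proof (induction k)
    case 0
    then show ?case using t by (simp add: numeral_2_eq_2)
  next
    case (Suc k)
    have "c \<circ> transpose (Suc k) (Suc (Suc k)) \<circ> inv c \<in> H"
      using Suc closed c c_inv by (simp add: c_def)
    moreover have "c (Suc k) = Suc (Suc k)" "c (Suc (Suc k)) = Suc (Suc (Suc k))"
      using Suc.prems by (auto simp: c_def rotation_def)
    ultimately show ?case
      by (simp add: comp_transpose_comp_inv permutes_bij[OF c_perm])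
  qed
  have from_one: "transpose 1 (Suc k) \<in> H" if "Suc k \<le> n" for k
    using that
  proof (induction k)
    case 0
    then show ?case using id by (simp add: id_def)
  next
    case (Suc k)
    show ?case
    proof (cases "k = 0")
      case True
      then show ?thesis using t by (simp add: numeral_2_eq_2)
    next
      case False
      have "transpose 1 (Suc k) \<circ> transpose (Suc k) (Suc (Suc k)) \<circ> transpose 1 (Suc k) \<in> H"
        using Suc adjacent closed by simp
      then show ?thesis
        using False by (subst (asm) transpose_comp_triple) auto
    qed
  qed
  have all: "transpose a b \<in> H" if "a \<in> {1..n}" "b \<in> {1..n}" "a \<noteq> b" for a b
  proof -
    have *: "transpose 1 i \<in> H" "transpose i 1 \<in> H" if "i \<in> {1..n}" for i
      using from_one[of "i - 1"] that by (simp_all add: transpose_commute[of "Suc 0" i])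
    show ?thesis
    proof (cases "a = 1 \<or> b = 1")
      case True
      then show ?thesis using * that by blast
    next
      case False
      then have "transpose a 1 \<circ> transpose 1 b \<circ> transpose a 1 = transpose a b"
        using that by (intro transpose_comp_triple) auto
      then show ?thesis
        using closed[OF closed[OF *(2)[OF that(1)] *(1)[OF that(2)]] *(2)[OF that(1)]] by metis
    qed
  qed
  show ?thesis
    using p finite_atLeastAtMost[of 1 n]
  proof (induction rule: permutes_induct)
    case id
    show ?case by (fact id)
  next
    case (swap a b p)
    then show ?case by (intro closed all)
  qed
qed

section \<open>The endomorphisms of a Brandt semigroup\<close>

definition const_map :: "nat \<Rightarrow> brandt \<Rightarrow> brandt \<Rightarrow> brandt" where
  "const_map n b = (\<lambda>x\<in>Brandt n. b)"

definition perm_map :: "nat \<Rightarrow> (nat \<Rightarrow> nat) \<Rightarrow> brandt \<Rightarrow> brandt" where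
  "perm_map n p = (\<lambda>x\<in>Brandt n. case x of Elem i j \<Rightarrow> Elem (p i) (p j) | Theta \<Rightarrow> Theta)"

abbreviation perm_maps :: "nat \<Rightarrow> (brandt \<Rightarrow> brandt) set" where
  "perm_maps n \<equiv> perm_map n ` {p. p permutes {1..n}}"

abbreviation diag_const_maps :: "nat \<Rightarrow> (brandt \<Rightarrow> brandt) set" where
  "diag_const_maps n \<equiv> (\<lambda>k. const_map n (Elem k k)) ` {1..n}"

lemma Theta_in_Brandt [simp]: "Theta \<in> Brandt n"
  by (simp add: Brandt_def)

lemma Elem_in_Brandt [simp]: "Elem i j \<in> Brandt n \<longleftrightarrow> i \<in> {1..n} \<and> j \<in> {1..n}"
  by (simp add: Brandt_def)

lemma const_map_apply [simp]: "x \<in> Brandt n \<Longrightarrow> const_map n b x = b"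
  by (simp add: const_map_def)

lemma perm_map_Theta [simp]: "perm_map n p Theta = Theta"
  by (simp add: perm_map_def)

lemma perm_map_Elem [simp]:
  "i \<in> {1..n} \<Longrightarrow> j \<in> {1..n} \<Longrightarrow> perm_map n p (Elem i j) = Elem (p i) (p j)"
  by (simp add: perm_map_def)

lemma perm_map_in_Brandt:
  assumes "p permutes {1..n}" "x \<in> Brandt n"
  shows "perm_map n p x \<in> Brandt n"
  using assms by (cases x) (simp_all only: Elem_in_Brandt perm_map_Elem perm_map_Theta
      Theta_in_Brandt permutes_in_image)

lemma const_map_in_End:
  assumes "b \<in> Brandt n" "brandt_add b b = b"
  shows "const_map n b \<in> semigroup_End (Brandt n) brandt_add"
  using assms by (auto simp: semigroup_End_def const_map_def brandt_add_closed)

lemma perm_map_in_End: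
  assumes p: "p permutes {1..n}"
  shows "perm_map n p \<in> semigroup_End (Brandt n) brandt_add"
proof -
  have "perm_map n p \<in> Brandt n \<rightarrow>\<^sub>E Brandt n"
    using perm_map_in_Brandt[OF p] by (auto simp: perm_map_def)
  moreover have "perm_map n p (brandt_add x y) = brandt_add (perm_map n p x) (perm_map n p y)"
    if "x \<in> Brandt n" "y \<in> Brandt n" for x y
    using that permutes_inj[OF p]
    by (cases x; cases y) (auto simp: inj_eq simp del: atLeastAtMost_iff)
  ultimately show ?thesis
    by (simp add: semigroup_End_def)
qed

lemma End_eq_const_map:
  assumes "f \<in> semigroup_End (Brandt n) brandt_add" "\<And>x. x \<in> Brandt n \<Longrightarrow> f x = b"
  shows "f = const_map n b"
  using assms by (intro ext) (auto simp: semigroup_End_def const_map_def PiE_def extensional_def)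

lemma brandt_idempotentD: "brandt_add b b = b \<Longrightarrow> b = Theta \<or> (\<exists>k. b = Elem k k)"
  by (cases b) (auto split: if_splits)

lemma End_Brandt_cases:
  assumes f: "f \<in> semigroup_End (Brandt n) brandt_add"
  shows "f \<in> perm_maps n \<union> diag_const_maps n \<union> {const_map n Theta}"
proof -
  have add: "f (brandt_add x y) = brandt_add (f x) (f y)"
    if "x \<in> Brandt n" "y \<in> Brandt n" for x y
    using f that by (simp add: semigroup_End_def)
  have into: "f x \<in> Brandt n" if "x \<in> Brandt n" for x
    using f that by (auto simp: semigroup_End_def)
  have "brandt_add (f Theta) (f Theta) = f Theta"
    using add[of Theta Theta] by simp
  then consider k where "f Theta = Elem k k" | "f Theta = Theta"
    using brandt_idempotentD by blast
  then show ?thesis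
  proof cases
    case 1
    \<comment> \<open>From \<open>x + \<vartheta> = \<vartheta>\<close>, the image of \<open>x\<close> must be absorbed by \<open>(k,k)\<close>.\<close>
    have "f x = Elem k k" if x: "x \<in> Brandt n" for x
    proof -
      have "brandt_add (f x) (Elem k k) = Elem k k"
        using add[OF x, of Theta] 1 by (cases x) auto
      then show ?thesis
        by (cases "f x") (auto split: if_splits)
    qed
    then have "f = const_map n (Elem k k)"
      by (rule End_eq_const_map[OF f])
    moreover have "k \<in> {1..n}"
      using into[of Theta] 1 by simp
    ultimately show ?thesis by blast
  next
    case Theta: 2
    show ?thesis
    proof (cases "\<exists>i\<in>{1..n}. \<exists>j\<in>{1..n}. f (Elem i j) = Theta")
      case True
      then obtain i j where ij: "i \<in> {1..n}" "j \<in> {1..n}" "f (Elem i j) = Theta"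
        by blast
      \<comment> \<open>Every pair factors through \<open>(i,j)\<close>: \<open>(k,l) = (k,i) + (i,j) + (j,l)\<close>.\<close>
      have "f x = Theta" if x: "x \<in> Brandt n" for x
      proof (cases x)
        case (Elem k l)
        have "brandt_add (f (Elem k i)) (brandt_add (f (Elem i j)) (f (Elem j l)))
            = f (brandt_add (Elem k i) (brandt_add (Elem i j) (Elem j l)))"
          using x ij Elem by (simp add: add brandt_add_closed del: brandt_add.simps)
        then show ?thesis
          using ij Elem by (cases "f (Elem k i)") auto
      qed (use Theta in simp)
      then have "f = const_map n Theta"
        by (rule End_eq_const_map[OF f])
      then show ?thesis by blast
    next
      case False
      have "\<exists>k. f (Elem i i) = Elem k k" if i: "i \<in> {1..n}" for i
      proof -
        have "brandt_add (f (Elem i i)) (f (Elem i i)) = f (Elem i i)"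
          using add[of "Elem i i" "Elem i i", symmetric] i by simp
        then show ?thesis
          using brandt_idempotentD False i by blast
      qed
      then obtain q where q: "\<And>i. i \<in> {1..n} \<Longrightarrow> f (Elem i i) = Elem (q i) (q i)"
        by metis
      \<comment> \<open>A map that permutes a set is the identity outside it, whereas \<open>q\<close> is arbitrary there.\<close>
      define p where "p i = (if i \<in> {1..n} then q i else i)" for i
      have fp: "f (Elem i i) = Elem (p i) (p i)" if "i \<in> {1..n}" for i
        using q that by (simp add: p_def)
      have "p permutes {1..n}"
      proof (rule inj_imp_permutes)
        \<comment> \<open>Distinct diagonal elements are orthogonal, and so must be their images.\<close>
        show "inj_on p {1..n}"
        proof (rule inj_onI)
          fix i j assume *: "i \<in> {1..n}" "j \<in> {1..n}" "p i = p j"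
          show "i = j"
            using add[of "Elem i i" "Elem j j"] * fp Theta by (auto split: if_splits)
        qed
        show "p i \<in> {1..n}" if "i \<in> {1..n}" for i
          using into[of "Elem i i"] fp[OF that] that by simp
      qed (auto simp: p_def)
      moreover have "f = perm_map n p"
      proof
        fix x
        show "f x = perm_map n p x"
        proof (cases "x \<in> Brandt n")
          case x: True
          show ?thesis
          proof (cases x)
            case (Elem i j)
            then have ij: "i \<in> {1..n}" "j \<in> {1..n}"
              using x by auto
            obtain k l where kl: "f (Elem i j) = Elem k l"
              using False ij by (metis brandt.exhaust)
            have "brandt_add (Elem (p i) (p i)) (Elem k l) = Elem k l"
              using add[of "Elem i i" "Elem i j", symmetric] ij kl fp by simp
            then have "k = p i"
              by (simp split: if_splits)
            moreover have "brandt_add (Elem k l) (Elem (p j) (p j)) = Elem k l"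
              using add[of "Elem i j" "Elem j j", symmetric] ij kl fp by simp
            then have "l = p j"
              by (simp split: if_splits)
            ultimately show ?thesis
              using Elem kl ij by (simp del: atLeastAtMost_iff)
          qed (use Theta in simp)
        next
          case False
          then show ?thesis
            using f by (auto simp: semigroup_End_def perm_map_def PiE_def extensional_def)
        qed
      qed
      ultimately show ?thesis by blast
    qed
  qed
qed

theorem semigroup_End_Brandt:
  "semigroup_End (Brandt n) brandt_add =
     perm_maps n \<union> diag_const_maps n \<union> {const_map n Theta}"
proof
  show "semigroup_End (Brandt n) brandt_add
      \<subseteq> perm_maps n \<union> diag_const_maps n \<union> {const_map n Theta}"
    using End_Brandt_cases by blast
  show "perm_maps n \<union> diag_const_maps n \<union> {const_map n Theta}
      \<subseteq> semigroup_End (Brandt n) brandt_add"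
    using perm_map_in_End const_map_in_End by auto
qed

section \<open>Products of endomorphisms\<close>

lemma End_mult_apply [simp]: "x \<in> S \<Longrightarrow> End_mult S f g x = g (f x)"
  by (simp add: End_mult_def compose_def)

text \<open>Composition is written from left to right in the endomorphism semigroup, hence the swap.\<close>

lemma perm_map_mult:
  assumes "p permutes {1..n}"
  shows "End_mult (Brandt n) (perm_map n p) (perm_map n q) = perm_map n (q \<circ> p)"
proof
  fix x
  show "End_mult (Brandt n) (perm_map n p) (perm_map n q) x = perm_map n (q \<circ> p) x"
  proof (cases "x \<in> Brandt n")
    case True
    then show ?thesis
      using permutes_in_image[OF assms] by (cases x) (simp_all del: atLeastAtMost_iff)
  qed (simp add: End_mult_def compose_def perm_map_def)
qed

lemma const_map_mult:
  "b \<in> Brandt n \<Longrightarrow> End_mult (Brandt n) (const_map n b) g = const_map n (g b)"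
  by (auto simp: End_mult_def compose_def const_map_def fun_eq_iff)

lemma mult_const_map:
  assumes "f \<in> semigroup_End (Brandt n) brandt_add"
  shows "End_mult (Brandt n) f (const_map n b) = const_map n b"
  using assms by (auto simp: End_mult_def compose_def const_map_def fun_eq_iff semigroup_End_def)

lemma const_map_notin_perm_maps:
  assumes "n \<ge> 1"
  shows "const_map n b \<notin> perm_maps n"
proof
  assume "const_map n b \<in> perm_maps n"
  then obtain p where eq: "perm_map n p = const_map n b"
    by auto
  have "Theta = b"
    using fun_cong[OF eq, of Theta] by simp
  moreover have "Elem (p 1) (p 1) = b"
    using fun_cong[OF eq, of "Elem 1 1"] assms by simp
  ultimately show False by simp
qed

lemma perm_maps_neq_const_map:
  assumes "n \<ge> 1" "f \<in> perm_maps n"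
  shows "f \<noteq> const_map n b"
proof
  assume eq: "f = const_map n b"
  show False
    using assms(2) const_map_notin_perm_maps[OF assms(1)] unfolding eq by contradiction
qed

lemma const_map_eq_iff [simp]: "const_map n a = const_map n b \<longleftrightarrow> a = b"
  by (metis Theta_in_Brandt const_map_apply)

section \<open>Four generators suffice\<close>

lemma End_Brandt_generated:
  assumes n: "n \<ge> 2"
  defines "U \<equiv> {perm_map n (transpose 1 2), perm_map n (rotation n),
                const_map n (Elem 1 1), const_map n Theta}"
  shows "subsemigroup_gen (End_mult (Brandt n)) U = semigroup_End (Brandt n) brandt_add"
    (is "?G = ?E")
proof
  have t: "transpose 1 2 permutes {1..n}"
    using n by (intro permutes_swap_id) auto
  have "U \<subseteq> ?E"
    using n t rotation_permutes by (auto simp: U_def intro!: perm_map_in_End const_map_in_End)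
  then show "?G \<subseteq> ?E"
    by (rule subsemigroup_gen_least) (simp add: End_mult_closed brandt_add_closed)
  have perm: "perm_map n p \<in> ?G" if "p permutes {1..n}" for p
  proof -
    define H where "H = {p. p permutes {1..n} \<and> perm_map n p \<in> ?G}"
    have "p \<in> H"
    proof (rule permutations_generated_by_transposition_and_rotation[OF n _ _ _ that])
      show "transpose 1 2 \<in> H" "rotation n \<in> H"
        using t rotation_permutes by (auto simp: H_def U_def intro: subsemigroup_gen.base)
      show "p \<circ> q \<in> H" if "p \<in> H" "q \<in> H" for p q
        using that subsemigroup_gen.mult[of "perm_map n q" "End_mult (Brandt n)" U "perm_map n p"]
        by (simp add: H_def permutes_compose perm_map_mult)
    qed
    then show ?thesis by (simp add: H_def)
  qed
  have diag: "const_map n (Elem k k) \<in> ?G" if k: "k \<in> {1..n}" for k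
  proof -
    have "transpose 1 k permutes {1..n}"
      using k n by (intro permutes_swap_id) auto
    then have "End_mult (Brandt n) (const_map n (Elem 1 1)) (perm_map n (transpose 1 k)) \<in> ?G"
      by (intro subsemigroup_gen.mult perm) (simp add: U_def subsemigroup_gen.base)
    then show ?thesis
      using n by (simp add: const_map_mult)
  qed
  have "const_map n Theta \<in> ?G"
    by (simp add: U_def subsemigroup_gen.base)
  then show "?E \<subseteq> ?G"
    unfolding semigroup_End_Brandt using perm diag by blast
qed

section \<open>Four generators are needed\<close>

context
  fixes n :: nat and U :: "(brandt \<Rightarrow> brandt) set"
  assumes generates: "subsemigroup_gen (End_mult (Brandt n)) U = semigroup_End (Brandt n) brandt_add"
begin

lemma generators_in_End: "U \<subseteq> semigroup_End (Brandt n) brandt_add"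
  unfolding generates[symmetric] by (intro subsetI subsemigroup_gen.base)

text \<open>
  Permutations preserve the diagonal, so the endomorphisms other than the constant map onto
  \<open>\<vartheta>\<close> are closed under composition.
\<close>

lemma const_Theta_generator:
  assumes n: "n \<ge> 1"
  shows "const_map n Theta \<in> U"
proof (rule ccontr)
  assume notin: "const_map n Theta \<notin> U"
  define V where "V = perm_maps n \<union> diag_const_maps n"
  have "subsemigroup_gen (End_mult (Brandt n)) U \<subseteq> V"
  proof (rule subsemigroup_gen_least)
    show "U \<subseteq> V"
      using generators_in_End notin unfolding V_def semigroup_End_Brandt by blast
    fix f g assume fg: "f \<in> V" "g \<in> V"
    have fE: "f \<in> semigroup_End (Brandt n) brandt_add"
      using fg by (auto simp: V_def semigroup_End_Brandt)
    consider (const) "g \<in> diag_const_maps n"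
      | (perm) p q where "p permutes {1..n}" "q permutes {1..n}" "f = perm_map n p" "g = perm_map n q"
      | (diag) k q where "k \<in> {1..n}" "q permutes {1..n}" "f = const_map n (Elem k k)"
          "g = perm_map n q"
      using fg by (auto simp: V_def)
    then show "End_mult (Brandt n) f g \<in> V"
    proof cases
      case const
      then have "End_mult (Brandt n) f g = g"
        using mult_const_map[OF fE] by blast
      then show ?thesis using fg by simp
    next
      case perm
      then have "End_mult (Brandt n) f g = perm_map n (q \<circ> p)"
        by (simp add: perm_map_mult)
      moreover have "q \<circ> p permutes {1..n}"
        using perm by (simp add: permutes_compose)
      ultimately show ?thesis unfolding V_def by blast
    next
      case diag
      then have "End_mult (Brandt n) f g = const_map n (Elem (q k) (q k))" "q k \<in> {1..n}"
        using permutes_in_image[OF diag(2)] by (simp_all add: const_map_mult del: atLeastAtMost_iff)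
      then show ?thesis unfolding V_def by blast
    qed
  qed
  moreover have "const_map n Theta \<in> semigroup_End (Brandt n) brandt_add"
    by (simp add: semigroup_End_Brandt)
  ultimately have "const_map n Theta \<in> V"
    using generates by blast
  then show False
    using const_map_notin_perm_maps[OF n] unfolding V_def by auto
qed

text \<open>Otherwise all generators, and hence all endomorphisms, would fix \<open>\<vartheta>\<close>.\<close>

lemma diag_const_generator:
  assumes n: "n \<ge> 1"
  shows "\<exists>k\<in>{1..n}. const_map n (Elem k k) \<in> U"
proof (rule ccontr)
  assume notin: "\<not> ?thesis"
  have "subsemigroup_gen (End_mult (Brandt n)) U \<subseteq> {f. f Theta = Theta}"
  proof (rule subsemigroup_gen_least)
    show "U \<subseteq> {f. f Theta = Theta}"
    proof
      fix f assume "f \<in> U"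
      then have "f \<in> perm_maps n \<union> {const_map n Theta}"
        using generators_in_End notin unfolding semigroup_End_Brandt by blast
      then show "f \<in> {f. f Theta = Theta}"
        by auto
    qed
  qed simp
  moreover have "const_map n (Elem 1 1) \<in> semigroup_End (Brandt n) brandt_add"
    using n by (intro const_map_in_End) auto
  ultimately have "const_map n (Elem 1 1) Theta = Theta"
    using generates by blast
  then show False by simp
qed

text \<open>
  The centralizer of any set of permutations, together with the constant maps, is closed under
  composition, so it is everything as soon as it contains the generators. With at most one
  permutation among the generators this applies twice: the generator centralizes itself, hence
  every permutation centralizes it; so it lies in the centre, hence every permutation does.
\<close>

lemma two_perm_generators:
  assumes n: "n \<ge> 3"
  shows "\<exists>f\<in>U \<inter> perm_maps n. \<exists>g\<in>U \<inter> perm_maps n. f \<noteq> g"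
proof (rule ccontr)
  assume one: "\<not> ?thesis"
  define C where "C A = {f \<in> perm_maps n. \<forall>g\<in>A. \<forall>x\<in>Brandt n. g (f x) = f (g x)}" for A
  have commute: "g (f x) = f (g x)" if "f \<in> C A" "g \<in> A" "x \<in> Brandt n" for f g x A
    using that unfolding C_def by blast
  define K where "K = diag_const_maps n \<union> {const_map n Theta}"
  \<comment> \<open>The constant maps form an ideal, so adding them keeps a set of permutations closed.\<close>
  have gen_centralizer: "perm_maps n \<subseteq> C A" if U: "U \<inter> perm_maps n \<subseteq> C A" and A: "A \<subseteq> perm_maps n" for A
  proof -
    have "subsemigroup_gen (End_mult (Brandt n)) U \<subseteq> C A \<union> K"
    proof (rule subsemigroup_gen_least)
      show "U \<subseteq> C A \<union> K"
        using generators_in_End U unfolding K_def semigroup_End_Brandt by blast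
      fix f g assume fg: "f \<in> C A \<union> K" "g \<in> C A \<union> K"
      have E: "C A \<union> K \<subseteq> semigroup_End (Brandt n) brandt_add"
        by (auto simp: C_def K_def semigroup_End_Brandt)
      show "End_mult (Brandt n) f g \<in> C A \<union> K"
      proof (cases "f \<in> C A \<and> g \<in> C A")
        case True
        then obtain p q where p: "p permutes {1..n}" "f = perm_map n p"
          and q: "q permutes {1..n}" "g = perm_map n q"
          by (auto simp: C_def)
        have "h (End_mult (Brandt n) f g x) = End_mult (Brandt n) f g (h x)"
          if h: "h \<in> A" and x: "x \<in> Brandt n" for h x
        proof -
          have "f x \<in> Brandt n"
            using p x perm_map_in_Brandt by blast
          moreover have "h x \<in> Brandt n"
            using A h x perm_map_in_Brandt by blast
          ultimately have "h (g (f x)) = g (f (h x))"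
            using True commute[OF _ h, of g "f x"] commute[OF _ h x, of f] by metis
          then show ?thesis
            using x \<open>h x \<in> Brandt n\<close> by simp
        qed
        moreover have "End_mult (Brandt n) f g \<in> perm_maps n"
          using p q by (simp add: perm_map_mult permutes_compose)
        ultimately show ?thesis unfolding C_def by blast
      next
        case False
        then consider b where "g = const_map n b" "const_map n b \<in> K"
          | b where "f = const_map n b" "b \<in> Brandt n"
          using fg by (auto simp: K_def)
        then show ?thesis
        proof cases
          case 1
          then show ?thesis using fg E mult_const_map by auto
        next
          case 2
          then have eq: "End_mult (Brandt n) f g = const_map n (g b)"
            by (simp add: const_map_mult)
          have "End_mult (Brandt n) f g \<in> semigroup_End (Brandt n) brandt_add"
            using fg E by (intro End_mult_closed brandt_add_closed) auto
          then show ?thesis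
            using eq n const_map_notin_perm_maps[of n "g b"]
            unfolding K_def semigroup_End_Brandt by force
        qed
      qed
    qed
    moreover have "perm_maps n \<inter> K = {}"
    proof -
      have "f \<notin> perm_maps n" if f: "f \<in> K" for f
      proof -
        obtain b where b: "f = const_map n b"
          using f unfolding K_def by blast
        show ?thesis
          unfolding b using n by (intro const_map_notin_perm_maps) simp
      qed
      then show ?thesis by blast
    qed
    ultimately show ?thesis
      using generates semigroup_End_Brandt by blast
  qed
  have "U \<inter> perm_maps n \<subseteq> C (U \<inter> perm_maps n)"
  proof
    fix f assume f: "f \<in> U \<inter> perm_maps n"
    then have "U \<inter> perm_maps n = {f}"
      using one by blast
    moreover have "f \<in> perm_maps n"
      using f by blast
    ultimately show "f \<in> C (U \<inter> perm_maps n)"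
      unfolding C_def by simp
  qed
  then have generators_central: "perm_maps n \<subseteq> C (U \<inter> perm_maps n)"
    by (rule gen_centralizer) blast
  have "U \<inter> perm_maps n \<subseteq> C (perm_maps n)"
  proof
    fix f assume f: "f \<in> U \<inter> perm_maps n"
    have "g (f x) = f (g x)" if "g \<in> perm_maps n" "x \<in> Brandt n" for g x
      using commute[OF subsetD[OF generators_central that(1)] f that(2)] by (rule sym)
    then show "f \<in> C (perm_maps n)"
      unfolding C_def using f by (intro CollectI conjI ballI) simp_all
  qed
  then have central: "perm_maps n \<subseteq> C (perm_maps n)"
    by (rule gen_centralizer) blast
  \<comment> \<open>The transpositions \<open>(1 2)\<close> and \<open>(2 3)\<close> do not commute; test them at \<open>1\<close>.\<close>
  define f where "f = perm_map n (transpose 1 2)"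
  define g where "g = perm_map n (transpose 2 3)"
  have "f \<in> perm_maps n" "g \<in> perm_maps n"
    using n by (auto simp: f_def g_def intro!: imageI permutes_swap_id)
  then have "g (f (Elem 1 1)) = f (g (Elem 1 1))"
    using central n by (intro commute[of _ "perm_maps n"]) auto
  then show False
    using n by (simp add: f_def g_def)
qed

lemma generating_set_card:
  assumes n: "n \<ge> 3" and fin: "finite U"
  shows "card U \<ge> 4"
proof -
  obtain f g where fg: "f \<in> U" "g \<in> U" "f \<in> perm_maps n" "g \<in> perm_maps n" "f \<noteq> g"
    using two_perm_generators[OF n] by blast
  obtain k where k: "const_map n (Elem k k) \<in> U"
    using diag_const_generator[OF order_trans[OF _ n]] by auto
  have "const_map n Theta \<in> U"
    using const_Theta_generator n by simp
  then have "{f, g, const_map n (Elem k k), const_map n Theta} \<subseteq> U"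
    using fg k by blast
  moreover have "card {f, g, const_map n (Elem k k), const_map n Theta} = 4"
  proof -
    have "f \<noteq> const_map n b" "g \<noteq> const_map n b" for b
      using n perm_maps_neq_const_map[OF _ fg(3)] perm_maps_neq_const_map[OF _ fg(4)] by simp_all
    then show ?thesis
      using fg(5) by simp
  qed
  ultimately show ?thesis
    using card_mono[OF fin, of "{f, g, const_map n (Elem k k), const_map n Theta}"] by simp
qed

end

section \<open>The lower rank\<close>

theorem theorem1p5:
  fixes n :: nat
  assumes "n \<ge> 3"
  shows "lower_rank (semigroup_End (Brandt n) brandt_add) (End_mult (Brandt n)) = 4"
  unfolding lower_rank_def
proof (rule Least_equality)
  define U where "U = {perm_map n (transpose 1 2), perm_map n (rotation n),
    const_map n (Elem 1 1), const_map n Theta}"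
  have gen: "subsemigroup_gen (End_mult (Brandt n)) U = semigroup_End (Brandt n) brandt_add"
    using End_Brandt_generated[of n] assms by (simp add: U_def)
  have fin: "finite U"
    by (simp add: U_def)
  \<comment> \<open>The lower bound also shows that the four generators are distinct.\<close>
  have "card U \<ge> 4"
    by (rule generating_set_card[OF gen assms fin])
  moreover have "card U \<le> 4"
    unfolding U_def
    using card_length[of "[perm_map n (transpose 1 2), perm_map n (rotation n),
      const_map n (Elem 1 1), const_map n Theta]"] by simp
  ultimately have "card U = 4" by simp
  then show "\<exists>U. U \<subseteq> semigroup_End (Brandt n) brandt_add \<and> finite U \<and>
      subsemigroup_gen (End_mult (Brandt n)) U = semigroup_End (Brandt n) brandt_add \<and> card U = 4"
    using gen generators_in_End[OF gen] fin by blast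
next
  fix k
  assume "\<exists>U. U \<subseteq> semigroup_End (Brandt n) brandt_add \<and> finite U \<and>
    subsemigroup_gen (End_mult (Brandt n)) U = semigroup_End (Brandt n) brandt_add \<and> card U = k"
  then obtain U where "finite U" "card U = k"
    "subsemigroup_gen (End_mult (Brandt n)) U = semigroup_End (Brandt n) brandt_add"
    by blast
  then show "4 \<le> k"
    using generating_set_card assms by metis
qed

end
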